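(* Let $A$ be a real $m \times n$ matrix with full column rank and nonzero rows $a_1, \ldots, a_m \in \mathbb{R}^n$, let $b \in \mathbb{R}^m$ be such that the system $Ax = b$ is consistent, and let $x \in \mathbb{R}^n$ denote its solution. Let $r \in \mathbb{R}^m$ be an arbitrary error vector (the system with right-hand side $b + r$ is not required to be consistent). Let $x_0 \in \mathbb{R}^n$ be an arbitrary initial estimate, and for $k \ge 0$ let $x_k^*$ be the $k$-th iterate of the noisy randomized Kaczmarz method run with $Ax \approx b + r$, started at $x_0^* = x_0$. Then for every $k \geq 0$, $$ \mathbb{E}\|x_k^* - x\|_2 \leq \Big(1 - \frac{1}{R}\Big)^{k/2}\|x_{0} - x\|_2 + \sqrt{R}\,\gamma, $$ where $R = \|A^{-1}\|^2\|A\|_F^2$, $\gamma = \max_{1 \le i \le m} \frac{|r_i|}{\|a_i\|_2}$, and the expectation is taken over the random choice of the rows in the algorithm.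
   Context: Notation: $\|\cdot\|_2$ is the Euclidean norm on vectors, $\|A\|_F$ is the Frobenius norm of $A$, and $\langle \cdot, \cdot \rangle$ is the standard inner product on $\mathbb{R}^n$. For a matrix $A$ with full column rank (not necessarily square), $\|A^{-1}\|$ is defined by $$\|A^{-1}\| = \inf\{M : M\|Az\|_2 \geq \|z\|_2 \text{ for all } z \in \mathbb{R}^n\}.$$ Noisy randomized Kaczmarz method run with $Ax \approx b + r$: starting from a deterministic vector $x_0^* = x_0 \in \mathbb{R}^n$, at each iteration $k = 0, 1, 2, \ldots$ an index $i = i_k \in \{1, \ldots, m\}$ is chosen at random, independently of the choices in the previous iterations, with $$\Pr(i_k = i) = \frac{\|a_i\|_2^2}{\|A\|_F^2}, \qquad i = 1, \ldots, m,$$ and one sets $$ x_{k+1}^* = x_k^* + \frac{b_{i} + r_{i} - \langle a_{i}, x_k^* \rangle}{\|a_{i}\|_2^2}\, a_{i}, $$ that is, $x_{k+1}^*$ is the orthogonal projection of $x_k^*$ onto the hyperplane $\{z \in \mathbb{R}^n : \langle a_i, z\rangle = b_i + r_i\}$. *)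

theory Defs
  imports "HOL-Probability.Probability"
begin

text \<open>
  The library norm on \<^typ>\<open>real^'n^'m\<close> is the Euclidean norm of the vector of Euclidean row
  norms, that is, the Frobenius norm and not the operator norm; throughout,
  \<^term>\<open>norm A\<close> therefore denotes the Frobenius norm of the matrix \<open>A\<close>.
\<close>

lemma norm_matrix_eq_Frobenius:
  fixes A :: "real^'n^'m"
  shows "norm A = sqrt (\<Sum>i\<in>UNIV. \<Sum>j\<in>UNIV. (A $ i $ j)\<^sup>2)"
  by (simp add: norm_vec_def L2_set_def sum_nonneg)

text \<open>
  The quantity written \<open>\<parallel>A\<^sup>-\<^sup>1\<parallel>\<close> for a possibly non-square matrix \<open>A\<close> of full column rank.
  There the set is nonempty and bounded below, so that \<^const>\<open>Inf\<close> is its infimum; for other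
  matrices the set is empty and the value is meaningless.
\<close>

definition inverse_norm :: "real^'n^'m \<Rightarrow> real" where
  "inverse_norm A = Inf {M. \<forall>z. M * norm (A *v z) \<ge> norm z}"

text \<open>
  Iterates of the Kaczmarz method for the right-hand side \<open>b + r\<close> along a given index sequence:
  \<open>idx k\<close> is the row used in the step from iterate \<open>k\<close> to iterate \<open>k + 1\<close>.
\<close>

primrec noisy_kaczmarz ::
  "real^'n^'m \<Rightarrow> real^'m \<Rightarrow> real^'m \<Rightarrow> real^'n \<Rightarrow> (nat \<Rightarrow> 'm) \<Rightarrow> nat \<Rightarrow> real^'n" where
  "noisy_kaczmarz A b r x0 idx 0 = x0"
| "noisy_kaczmarz A b r x0 idx (Suc k) =
     (let xk = noisy_kaczmarz A b r x0 idx k; i = idx k in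
        xk + ((b $ i + r $ i - row i A \<bullet> xk) / (norm (row i A))\<^sup>2) *\<^sub>R row i A)"

end

theory Submission
  imports Defs
begin

text \<open>
  Write \<open>e k\<close> for the error of the \<open>k\<close>-th iterate and \<open>a i\<close> for the \<open>i\<close>-th row of \<open>A\<close>. A step
  with row \<open>i\<close> replaces the component of \<open>e k\<close> along \<open>a i\<close>, whose signed length is
  \<open>(a i \<bullet> e k) / norm (a i)\<close>, by a component of signed length \<open>r i / norm (a i)\<close>, and leaves the
  orthogonal complement alone. By Pythagoras (\<open>norm_kaczmarz_step\<close>) this gives
  \<open>(norm (e (k + 1)))\<^sup>2 = (norm (e k))\<^sup>2 - (a i \<bullet> e k)\<^sup>2 / (norm (a i))\<^sup>2
    + (r i)\<^sup>2 / (norm (a i))\<^sup>2\<close>,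
  and the last term is at most \<open>\<gamma>\<^sup>2\<close>.

  The row used in step \<open>k\<close> is independent of \<open>e k\<close>, which depends on the earlier rows only. Since
  row \<open>i\<close> has probability \<open>(norm (a i))\<^sup>2 / (norm A)\<^sup>2\<close>, the subtracted term has expectation
  \<open>E ((norm (A *v e k))\<^sup>2) / (norm A)\<^sup>2\<close>. Full column rank makes the infimum in
  \<open>inverse_norm\<close> an admissible constant (\<open>norm_le_inverse_norm\<close>), so this is at least
  \<open>E ((norm (e k))\<^sup>2) / R\<close>. Hence the mean squared errors \<open>s k\<close> satisfy
  \<open>s (k + 1) \<le> (1 - 1 / R) * s k + \<gamma>\<^sup>2\<close> (\<open>kaczmarz_mean_square_step\<close>). The fixed point
  of the map \<open>s \<mapsto> (1 - 1 / R) * s + \<gamma>\<^sup>2\<close> is \<open>R * \<gamma>\<^sup>2\<close>, so that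
  \<open>s k \<le> (1 - 1 / R) ^ k * (norm (e 0))\<^sup>2 + R * \<gamma>\<^sup>2\<close>.
  Since \<open>(E X)\<^sup>2 \<le> E (X\<^sup>2)\<close>, the claim follows by subadditivity of the square root.
\<close>

section \<open>Norm bounds for matrices of full column rank\<close>

lemma norm_le_inverse_norm:
  fixes A :: "real^'n^'m"
  assumes "rank A = CARD('n)"
  shows "norm z \<le> inverse_norm A * norm (A *v z)"
proof (cases "z = 0")
  case False
  have inj: "inj ((*v) A)"
    using assms by (simp add: full_rank_injective)
  then obtain B where B: "B > 0" "\<And>z. B * norm z \<le> norm (A *v z)"
    using linear_inj_bounded_below_pos[OF matrix_vector_mul_linear] by blast
  have pos: "norm (A *v z) > 0"
    using B(1) B(2)[of z] False by (smt (verit) mult_pos_pos zero_less_norm_iff)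
  have "norm z / norm (A *v z) \<le> Inf {M. \<forall>z. M * norm (A *v z) \<ge> norm z}"
  proof (rule cInf_greatest)
    have "1 / B \<in> {M. \<forall>z. M * norm (A *v z) \<ge> norm z}"
      using B by (simp add: field_simps)
    then show "{M. \<forall>z. M * norm (A *v z) \<ge> norm z} \<noteq> {}" by blast
  qed (use pos in \<open>auto simp: divide_le_eq\<close>)
  then show ?thesis
    using pos by (simp add: inverse_norm_def divide_le_eq)
qed simp

lemma norm_matrix_vector_squared:
  fixes A :: "real^'n^'m"
  shows "(norm (A *v z))\<^sup>2 = (\<Sum>i\<in>UNIV. (row i A \<bullet> z)\<^sup>2)"
  by (simp add: norm_vec_def L2_set_def sum_nonneg matrix_vector_mul_component row_def)

lemma norm_matrix_squared:
  fixes A :: "real^'n^'m"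
  shows "(norm A)\<^sup>2 = (\<Sum>i\<in>UNIV. (norm (row i A))\<^sup>2)"
  by (simp add: norm_vec_def[of A] L2_set_def sum_nonneg row_def)

lemma norm_matrix_vector_le:
  fixes A :: "real^'n^'m"
  shows "norm (A *v z) \<le> norm A * norm z"
proof (rule power2_le_imp_le)
  have "(row i A \<bullet> z)\<^sup>2 \<le> (norm (row i A))\<^sup>2 * (norm z)\<^sup>2" for i
    using Cauchy_Schwarz_ineq[of "row i A" z] by (simp add: power2_norm_eq_inner)
  then show "(norm (A *v z))\<^sup>2 \<le> (norm A * norm z)\<^sup>2"
    by (simp add: norm_matrix_vector_squared norm_matrix_squared power_mult_distrib
        sum_distrib_right sum_mono)
qed simp

text \<open>Consequently \<open>1 - 1 / R\<close>, with \<open>R\<close> denoting this product, is nonnegative.\<close>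

lemma condition_number_ge_1:
  fixes A :: "real^'n^'m"
  assumes "rank A = CARD('n)"
  shows "1 \<le> (inverse_norm A)\<^sup>2 * (norm A)\<^sup>2"
proof -
  define z :: "real^'n" where "z = axis undefined 1"
  have z: "norm z = 1" by (simp add: z_def)
  have "1 \<le> inverse_norm A * norm (A *v z)"
    using norm_le_inverse_norm[OF assms, of z] z by simp
  moreover from this have "0 \<le> inverse_norm A"
    by (smt (verit) mult_nonneg_nonneg mult_minus_left norm_ge_zero)
  ultimately have "1 \<le> inverse_norm A * norm A"
    using norm_matrix_vector_le[of A z] z mult_left_mono by fastforce
  then show ?thesis
    by (metis one_le_power power_mult_distrib)
qed

section \<open>Iterates along a fixed index sequence\<close>

lemma norm_kaczmarz_step:
  fixes A :: "real^'n^'m" and b r :: "real^'m" and x x0 :: "real^'n"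
  assumes "row (idx k) A \<noteq> 0" and "A *v x = b"
  defines "e \<equiv> \<lambda>k. noisy_kaczmarz A b r x0 idx k - x"
  shows "(norm (e (Suc k)))\<^sup>2 = (norm (e k))\<^sup>2 - (row (idx k) A \<bullet> e k)\<^sup>2 / (norm (row (idx k) A))\<^sup>2
    + (r $ idx k / norm (row (idx k) A))\<^sup>2"
proof -
  define a where "a = row (idx k) A"
  define N where "N = (norm a)\<^sup>2"
  define s where "s = a \<bullet> e k"
  have N: "N > 0" using assms(1) by (simp add: N_def a_def)
  have "b $ idx k = a \<bullet> x"
    using assms(2) by (auto simp: a_def matrix_vector_mul_component row_def)
  then have Suc: "e (Suc k) = e k + ((r $ idx k - s) / N) *\<^sub>R a"
    by (simp add: e_def s_def N_def a_def Let_def inner_diff_right algebra_simps)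
  have "(norm (e k + c *\<^sub>R a))\<^sup>2 = (norm (e k))\<^sup>2 + 2 * c * s + c\<^sup>2 * N" for c
    unfolding power2_norm_eq_inner N_def s_def
    by (simp add: inner_add_left inner_add_right inner_commute[of "e k" a]
        power2_eq_square algebra_simps)
  then have "(norm (e (Suc k)))\<^sup>2 = (norm (e k))\<^sup>2 + 2 * ((r $ idx k - s) / N) * s
      + ((r $ idx k - s) / N)\<^sup>2 * N"
    by (simp add: Suc)
  also have "\<dots> = (norm (e k))\<^sup>2 - s\<^sup>2 / N + (r $ idx k)\<^sup>2 / N"
    using N by (simp add: field_simps power2_eq_square)
  finally show ?thesis
    by (simp add: s_def N_def a_def power_divide)
qed

lemma norm_kaczmarz_step_le:
  fixes A :: "real^'n^'m" and b r :: "real^'m" and x x0 :: "real^'n"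
  assumes "row (idx k) A \<noteq> 0" and "A *v x = b"
    and "\<bar>r $ idx k\<bar> / norm (row (idx k) A) \<le> \<gamma>"
  defines "e \<equiv> \<lambda>k. noisy_kaczmarz A b r x0 idx k - x"
  shows "(norm (e (Suc k)))\<^sup>2
    \<le> (norm (e k))\<^sup>2 - (row (idx k) A \<bullet> e k)\<^sup>2 / (norm (row (idx k) A))\<^sup>2 + \<gamma>\<^sup>2"
proof -
  have "(r $ idx k / norm (row (idx k) A))\<^sup>2 \<le> \<gamma>\<^sup>2"
    using power_mono[OF assms(3), of 2] by (simp add: power_divide)
  then show ?thesis
    using norm_kaczmarz_step[where idx = idx and k = k and ?x0.0 = x0, OF assms(1,2)]
    by (simp add: e_def)
qed

text \<open>A crude bound that is uniform in the indices; it makes all the expectations finite.\<close>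

lemma norm_kaczmarz_bounded:
  fixes A :: "real^'n^'m" and b r :: "real^'m" and x x0 :: "real^'n"
  assumes "\<And>i. row i A \<noteq> 0" and "A *v x = b"
    and "\<And>i. \<bar>r $ i\<bar> / norm (row i A) \<le> \<gamma>"
  shows "(norm (noisy_kaczmarz A b r x0 idx k - x))\<^sup>2 \<le> (norm (x0 - x))\<^sup>2 + real k * \<gamma>\<^sup>2"
proof (induction k)
  case (Suc k)
  have "(norm (noisy_kaczmarz A b r x0 idx (Suc k) - x))\<^sup>2
      \<le> (norm (noisy_kaczmarz A b r x0 idx k - x))\<^sup>2 + \<gamma>\<^sup>2"
    using norm_kaczmarz_step_le[where idx = idx and k = k and ?x0.0 = x0, OF assms(1,2,3)]
    by (smt (verit) divide_nonneg_nonneg zero_le_power2)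
  with Suc show ?case by (simp add: algebra_simps)
qed simp

lemma noisy_kaczmarz_cong:
  assumes "\<And>j. j < k \<Longrightarrow> idx j = idx' j"
  shows "noisy_kaczmarz A b r x0 idx k = noisy_kaczmarz A b r x0 idx' k"
  using assms by (induction k) (auto simp: Let_def)

lemma measurable_noisy_kaczmarz:
  fixes A :: "real^'n^'m"
  assumes "{..<k} \<subseteq> J"
  shows "(\<lambda>idx. noisy_kaczmarz A b r x0 idx k)
    \<in> borel_measurable (PiM J (\<lambda>_. count_space UNIV))"
  using assms
proof (induction k)
  case (Suc k)
  let ?P = "PiM J (\<lambda>_. count_space (UNIV :: 'm set))"
  have IH [measurable]: "(\<lambda>idx. noisy_kaczmarz A b r x0 idx k) \<in> borel_measurable ?P"
    using Suc by (simp add: lessThan_Suc)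
  have "(\<lambda>idx. idx k) \<in> ?P \<rightarrow>\<^sub>M count_space UNIV"
    using Suc.prems by (intro measurable_component_singleton) auto
  \<comment> \<open>There are finitely many rows, so the step splits into countably many cases.\<close>
  then show ?case
    unfolding noisy_kaczmarz.simps Let_def
    by (rule measurable_compose_countable[rotated]) measurable
qed simp

section \<open>Averaging over an independent index\<close>

text \<open>
  Averaging out the index. Independence is only required of each variable \<open>g i\<close> and the
  indicator of the event that the index is \<open>i\<close>.
\<close>

lemma (in prob_space) expectation_independent_index:
  fixes g :: "'i::finite \<Rightarrow> 'a \<Rightarrow> real" and J :: "'a \<Rightarrow> 'i"
  assumes J [measurable]: "J \<in> M \<rightarrow>\<^sub>M count_space UNIV"
    and ind: "\<And>i. indep_var borel (g i) borel (\<lambda>\<omega>. indicat_real {i} (J \<omega>))"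
    and int: "\<And>i. integrable M (g i)"
  shows "integrable M (\<lambda>\<omega>. g (J \<omega>) \<omega>)"
    and "expectation (\<lambda>\<omega>. g (J \<omega>) \<omega>)
      = (\<Sum>i\<in>UNIV. prob {\<omega> \<in> space M. J \<omega> = i} * expectation (g i))"
proof -
  have split: "g (J \<omega>) \<omega> = (\<Sum>i\<in>UNIV. g i \<omega> * indicat_real {i} (J \<omega>))" for \<omega>
    by (simp add: indicator_def if_distrib cong: if_cong)
  have int_ind: "integrable M (\<lambda>\<omega>. indicat_real {i} (J \<omega>))" for i
    by (rule integrable_const_bound[where B = 1]) (auto simp: indicator_def)
  have ev: "expectation (\<lambda>\<omega>. indicat_real {i} (J \<omega>)) = prob {\<omega> \<in> space M. J \<omega> = i}" for i
  proof -
    have "expectation (\<lambda>\<omega>. indicat_real {i} (J \<omega>))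
        = expectation (indicat_real {\<omega> \<in> space M. J \<omega> = i})"
      by (rule Bochner_Integration.integral_cong) (auto simp: indicator_def)
    then show ?thesis by simp
  qed
  have int_prod: "integrable M (\<lambda>\<omega>. g i \<omega> * indicat_real {i} (J \<omega>))" for i
    using indep_var_integrable[OF ind] int int_ind by simp
  then show "integrable M (\<lambda>\<omega>. g (J \<omega>) \<omega>)"
    unfolding split by (intro Bochner_Integration.integrable_sum)
  have "expectation (\<lambda>\<omega>. g i \<omega> * indicat_real {i} (J \<omega>))
      = prob {\<omega> \<in> space M. J \<omega> = i} * expectation (g i)" for i
    using indep_var_lebesgue_integral[OF ind] int int_ind by (simp add: ev mult.commute)
  then show "expectation (\<lambda>\<omega>. g (J \<omega>) \<omega>)
      = (\<Sum>i\<in>UNIV. prob {\<omega> \<in> space M. J \<omega> = i} * expectation (g i))"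
    unfolding split using int_prod by (subst Bochner_Integration.integral_sum) auto
qed

lemma (in prob_space) expectation_le_sqrt_second_moment:
  fixes X :: "'a \<Rightarrow> real"
  assumes "integrable M X" and "integrable M (\<lambda>\<omega>. (X \<omega>)\<^sup>2)"
  shows "expectation X \<le> sqrt (expectation (\<lambda>\<omega>. (X \<omega>)\<^sup>2))"
  using variance_positive[of X] variance_eq[OF assms] by (intro real_le_rsqrt) simp

section \<open>The error bound\<close>

text \<open>The mean squared error contracts by the factor \<open>1 - 1 / R\<close>, up to an additive \<open>\<gamma>\<^sup>2\<close>.\<close>

lemma (in prob_space) kaczmarz_mean_square_step:
  fixes A :: "real^'n^'m" and b r :: "real^'m" and x x0 :: "real^'n"
    and I :: "nat \<Rightarrow> 'a \<Rightarrow> 'm"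
  assumes rank: "rank A = CARD('n)"
    and rows: "\<And>i. row i A \<noteq> 0"
    and sol: "A *v x = b"
    and indep: "indep_vars (\<lambda>_. count_space UNIV) I UNIV"
    and distr: "\<And>i. prob {\<omega> \<in> space M. I k \<omega> = i} = (norm (row i A))\<^sup>2 / (norm A)\<^sup>2"
    and noise: "\<And>i. \<bar>r $ i\<bar> / norm (row i A) \<le> \<gamma>"
  defines "e \<equiv> \<lambda>k \<omega>. noisy_kaczmarz A b r x0 (\<lambda>j. I j \<omega>) k - x"
  defines "R \<equiv> (inverse_norm A)\<^sup>2 * (norm A)\<^sup>2"
  assumes int: "\<And>k. integrable M (\<lambda>\<omega>. (norm (e k \<omega>))\<^sup>2)"
  shows "expectation (\<lambda>\<omega>. (norm (e (Suc k) \<omega>))\<^sup>2)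
    \<le> (1 - 1 / R) * expectation (\<lambda>\<omega>. (norm (e k \<omega>))\<^sup>2) + \<gamma>\<^sup>2"
proof -
  let ?P = "\<lambda>J. PiM J (\<lambda>_. count_space (UNIV :: 'm set))"
  define Y where "Y = (\<lambda>\<omega>. restrict (\<lambda>j. I j \<omega>) {..<k})"
  define g where "g i idx = (row i A \<bullet> (noisy_kaczmarz A b r x0 idx k - x))\<^sup>2 / (norm (row i A))\<^sup>2"
    for i idx
  have R: "R \<ge> 1"
    unfolding R_def using rank by (rule condition_number_ge_1)
  have A: "(norm A)\<^sup>2 > 0"
    using R unfolding R_def by (smt (verit) mult_eq_0_iff zero_le_power2)
  have meas: "(\<lambda>idx. noisy_kaczmarz A b r x0 idx k) \<in> borel_measurable (?P {..<k})"
    by (rule measurable_noisy_kaczmarz) simp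
  have gm: "g i \<in> borel_measurable (?P {..<k})" for i
    unfolding g_def using meas by measurable
  have ind: "indep_var borel (\<lambda>\<omega>. g i (Y \<omega>)) borel (\<lambda>\<omega>. indicat_real {i} (I k \<omega>))" for i
  proof -
    have "(\<lambda>f. indicat_real {i} (f k)) \<in> borel_measurable (?P {k})"
      by measurable
    then have "indep_var borel (g i \<circ> Y) borel
        ((\<lambda>f. indicat_real {i} (f k)) \<circ> (\<lambda>\<omega>. restrict (\<lambda>j. I j \<omega>) {k}))"
      unfolding Y_def
      by (intro indep_var_compose[OF indep_var_restrict[OF indep]] gm) auto
    then show ?thesis by (simp add: comp_def)
  qed
  \<comment> \<open>Iterate \<open>k\<close> only sees the rows used before step \<open>k\<close>, which are those recorded in \<open>Y\<close>.\<close>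
  have gY: "g i (Y \<omega>) = (row i A \<bullet> e k \<omega>)\<^sup>2 / (norm (row i A))\<^sup>2" for i \<omega>
    unfolding g_def e_def Y_def
    by (subst noisy_kaczmarz_cong[where idx' = "\<lambda>j. I j \<omega>"]) auto
  have gi: "integrable M (\<lambda>\<omega>. g i (Y \<omega>))" for i
  proof (rule Bochner_Integration.integrable_bound[OF int[of k]])
    show "(\<lambda>\<omega>. g i (Y \<omega>)) \<in> borel_measurable M"
      using ind by (rule indep_var_rv1)
    have "(row i A \<bullet> z)\<^sup>2 / (norm (row i A))\<^sup>2 \<le> (norm z)\<^sup>2" for z
      using Cauchy_Schwarz_ineq[of "row i A" z] rows[of i]
      by (simp add: divide_le_eq power2_norm_eq_inner mult.commute)
    then show "AE \<omega> in M. norm (g i (Y \<omega>)) \<le> norm ((norm (e k \<omega>))\<^sup>2)"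
      by (simp add: gY)
  qed
  have "I k \<in> M \<rightarrow>\<^sub>M count_space UNIV"
    using indep by (simp add: indep_vars_def)
  note fresh = expectation_independent_index[OF this ind gi]
  have le: "(norm (e (Suc k) \<omega>))\<^sup>2 \<le> (norm (e k \<omega>))\<^sup>2 - g (I k \<omega>) (Y \<omega>) + \<gamma>\<^sup>2" for \<omega>
    using norm_kaczmarz_step_le[where idx = "\<lambda>j. I j \<omega>" and k = k and ?x0.0 = x0,
        OF rows sol noise]
    by (simp add: gY e_def)
  \<comment> \<open>The weights cancel the denominators in \<open>g\<close>, leaving the squared entries of \<open>A *v e k\<close>.\<close>
  have "expectation (\<lambda>\<omega>. g (I k \<omega>) (Y \<omega>))
      = (\<Sum>i\<in>UNIV. (norm (row i A))\<^sup>2 / (norm A)\<^sup>2 * expectation (\<lambda>\<omega>. g i (Y \<omega>)))"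
    using fresh(2) by (simp add: distr)
  also have "\<dots> = expectation (\<lambda>\<omega>. \<Sum>i\<in>UNIV. (norm (row i A))\<^sup>2 / (norm A)\<^sup>2 * g i (Y \<omega>))"
    using gi by (subst Bochner_Integration.integral_sum) auto
  also have "\<dots> = expectation (\<lambda>\<omega>. (norm (A *v e k \<omega>))\<^sup>2 / (norm A)\<^sup>2)"
    using rows by (simp add: gY norm_matrix_vector_squared sum_divide_distrib)
  finally have mean: "expectation (\<lambda>\<omega>. g (I k \<omega>) (Y \<omega>))
      = expectation (\<lambda>\<omega>. (norm (A *v e k \<omega>))\<^sup>2 / (norm A)\<^sup>2)" .
  have "(\<lambda>\<omega>. (norm (A *v e k \<omega>))\<^sup>2 / (norm A)\<^sup>2)
      = (\<lambda>\<omega>. \<Sum>i\<in>UNIV. (norm (row i A))\<^sup>2 / (norm A)\<^sup>2 * g i (Y \<omega>))"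
    using rows by (simp add: gY norm_matrix_vector_squared sum_divide_distrib)
  then have int_A: "integrable M (\<lambda>\<omega>. (norm (A *v e k \<omega>))\<^sup>2 / (norm A)\<^sup>2)"
    using gi by auto
  have "(norm z)\<^sup>2 / R \<le> (norm (A *v z))\<^sup>2 / (norm A)\<^sup>2" for z
  proof -
    have "(norm z)\<^sup>2 \<le> (inverse_norm A)\<^sup>2 * (norm (A *v z))\<^sup>2"
      using power_mono[OF norm_le_inverse_norm[OF rank, of z], of 2]
      by (simp add: power_mult_distrib)
    then have "(norm z)\<^sup>2 \<le> R * ((norm (A *v z))\<^sup>2 / (norm A)\<^sup>2)"
      using A by (simp add: R_def)
    then show ?thesis
      using R by (simp add: divide_le_eq mult.commute)
  qed
  then have "expectation (\<lambda>\<omega>. (norm (e k \<omega>))\<^sup>2 / R)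
      \<le> expectation (\<lambda>\<omega>. (norm (A *v e k \<omega>))\<^sup>2 / (norm A)\<^sup>2)"
    using int int_A by (intro integral_mono) auto
  then have lower: "expectation (\<lambda>\<omega>. (norm (e k \<omega>))\<^sup>2) / R \<le> expectation (\<lambda>\<omega>. g (I k \<omega>) (Y \<omega>))"
    by (simp add: mean)
  have "expectation (\<lambda>\<omega>. (norm (e (Suc k) \<omega>))\<^sup>2)
      \<le> expectation (\<lambda>\<omega>. (norm (e k \<omega>))\<^sup>2 - g (I k \<omega>) (Y \<omega>) + \<gamma>\<^sup>2)"
    using int fresh(1) le by (intro integral_mono) auto
  also have "\<dots> = expectation (\<lambda>\<omega>. (norm (e k \<omega>))\<^sup>2) - expectation (\<lambda>\<omega>. g (I k \<omega>) (Y \<omega>)) + \<gamma>\<^sup>2"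
    using int fresh(1) by (simp add: prob_space)
  also have "\<dots> \<le> (1 - 1 / R) * expectation (\<lambda>\<omega>. (norm (e k \<omega>))\<^sup>2) + \<gamma>\<^sup>2"
    using lower by (simp add: algebra_simps)
  finally show ?thesis .
qed

theorem theorem2p1:
  fixes A :: "real^'n^'m" and b r :: "real^'m" and x x0 :: "real^'n"
    and \<Omega> :: "'w measure" and I :: "nat \<Rightarrow> 'w \<Rightarrow> 'm"
    and R \<gamma> :: real and k :: nat
  assumes full_column_rank: "rank A = CARD('n)"
    and nonzero_rows: "\<And>i. row i A \<noteq> 0"
    and solution: "A *v x = b"
    and prob_space: "prob_space \<Omega>"
    and independent: "prob_space.indep_vars \<Omega> (\<lambda>_. count_space UNIV) I UNIV"
    and distribution:
      "\<And>j i. measure \<Omega> {\<omega> \<in> space \<Omega>. I j \<omega> = i} = (norm (row i A))\<^sup>2 / (norm A)\<^sup>2"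
    and R: "R = (inverse_norm A)\<^sup>2 * (norm A)\<^sup>2"
    and \<gamma>: "\<gamma> = Max (range (\<lambda>i. \<bar>r $ i\<bar> / norm (row i A)))"
  shows "prob_space.expectation \<Omega> (\<lambda>\<omega>. norm (noisy_kaczmarz A b r x0 (\<lambda>j. I j \<omega>) k - x))
    \<le> sqrt (1 - 1 / R) ^ k * norm (x0 - x) + sqrt R * \<gamma>"
proof -
  interpret prob_space \<Omega> by (rule prob_space)
  define e where "e = (\<lambda>k \<omega>. noisy_kaczmarz A b r x0 (\<lambda>j. I j \<omega>) k - x)"
  define q where "q = 1 - 1 / R"
  have R1: "R \<ge> 1"
    unfolding R using full_column_rank by (rule condition_number_ge_1)
  then have q: "q \<ge> 0" by (simp add: q_def)
  have noise: "\<bar>r $ i\<bar> / norm (row i A) \<le> \<gamma>" for i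
    unfolding \<gamma> by (rule Max_ge) auto
  have \<gamma>0: "\<gamma> \<ge> 0"
    using noise[of undefined] by (rule order_trans[rotated]) simp
  have I: "I j \<in> \<Omega> \<rightarrow>\<^sub>M count_space UNIV" for j
    using independent by (simp add: indep_vars_def)
  have em [measurable]: "e k \<in> borel_measurable \<Omega>" for k
  proof -
    have "(\<lambda>\<omega>. \<lambda>j\<in>UNIV. I j \<omega>) \<in> \<Omega> \<rightarrow>\<^sub>M PiM UNIV (\<lambda>_. count_space UNIV)"
      by (rule measurable_restrict) (rule I)
    from measurable_compose[OF this measurable_noisy_kaczmarz[where k = k]]
    have "(\<lambda>\<omega>. noisy_kaczmarz A b r x0 (\<lambda>j. I j \<omega>) k) \<in> borel_measurable \<Omega>"
      by (simp add: restrict_def)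
    then show ?thesis unfolding e_def by measurable
  qed
  have bound: "(norm (e k \<omega>))\<^sup>2 \<le> (norm (x0 - x))\<^sup>2 + real k * \<gamma>\<^sup>2" for k \<omega>
    unfolding e_def by (rule norm_kaczmarz_bounded[OF nonzero_rows solution noise])
  have int2: "integrable \<Omega> (\<lambda>\<omega>. (norm (e k \<omega>))\<^sup>2)" for k
    using bound by (intro integrable_const_bound[where B = "(norm (x0 - x))\<^sup>2 + real k * \<gamma>\<^sup>2"]) auto
  have int1: "integrable \<Omega> (\<lambda>\<omega>. norm (e k \<omega>))" for k
    using bound
    by (intro integrable_const_bound[where B = "sqrt ((norm (x0 - x))\<^sup>2 + real k * \<gamma>\<^sup>2)"])
      (auto intro: real_le_rsqrt)
  have step: "expectation (\<lambda>\<omega>. (norm (e (Suc k) \<omega>))\<^sup>2)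
      \<le> q * expectation (\<lambda>\<omega>. (norm (e k \<omega>))\<^sup>2) + \<gamma>\<^sup>2" for k
    using kaczmarz_mean_square_step[where k = k and ?x0.0 = x0, OF full_column_rank nonzero_rows solution
        independent distribution noise] int2
    unfolding e_def q_def R by blast
  have "expectation (\<lambda>\<omega>. (norm (e k \<omega>))\<^sup>2) \<le> q ^ k * (norm (x0 - x))\<^sup>2 + R * \<gamma>\<^sup>2"
  proof (induction k)
    case 0
    then show ?case using R1 by (simp add: e_def prob_space)
  next
    case (Suc k)
    have "expectation (\<lambda>\<omega>. (norm (e (Suc k) \<omega>))\<^sup>2)
        \<le> q * (q ^ k * (norm (x0 - x))\<^sup>2 + R * \<gamma>\<^sup>2) + \<gamma>\<^sup>2"
      using step[of k] mult_left_mono[OF Suc q] by linarith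
    also have "\<dots> = q ^ Suc k * (norm (x0 - x))\<^sup>2 + (q * R + 1) * \<gamma>\<^sup>2"
      by (simp add: algebra_simps)
    also have "q * R + 1 = R"
      using R1 by (simp add: q_def field_simps)
    finally show ?case .
  qed
  then have "expectation (\<lambda>\<omega>. norm (e k \<omega>)) \<le> sqrt (q ^ k * (norm (x0 - x))\<^sup>2 + R * \<gamma>\<^sup>2)"
    using expectation_le_sqrt_second_moment[OF int1 int2, of k]
    by (meson order_trans real_sqrt_le_mono)
  also have "\<dots> \<le> sqrt (q ^ k * (norm (x0 - x))\<^sup>2) + sqrt (R * \<gamma>\<^sup>2)"
    using q R1 by (intro sqrt_add_le_add_sqrt) auto
  also have "\<dots> = sqrt q ^ k * norm (x0 - x) + sqrt R * \<gamma>"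
    using \<gamma>0 by (simp add: real_sqrt_mult real_sqrt_power)
  finally show ?thesis
    by (simp add: e_def q_def)
qed

end
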